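(* Let $X$ be a set and let $\mathbf{R}:X^3\to X^3$ be an involutive, symmetric and boundarizable tetrahedron map. Let $\mathbf{J}:X^4\to X^4$ be the boundarization of $\mathbf{R}$. Then $\mathbf{R}$ and $\mathbf{J}$ satisfy the 3D reflection equation, i.e. the following equality of maps $X^9\to X^9$: $$\mathbf{R}_{489}\mathbf{J}_{3579}\mathbf{R}_{269}\mathbf{R}_{258}\mathbf{J}_{1678}\mathbf{J}_{1234}\mathbf{R}_{456}=\mathbf{R}_{456}\mathbf{J}_{1234}\mathbf{J}_{1678}\mathbf{R}_{258}\mathbf{R}_{269}\mathbf{J}_{3579}\mathbf{R}_{489}.$$
   Context: Products of maps denote composition (the rightmost map is applied first). For a map $\mathbf{R}:X^3\to X^3$ and $i<j<k$, $\mathbf{R}_{ijk}:X^n\to X^n$ is the map acting as $\mathbf{R}$ on the components $(x_i,x_j,x_k)$ (in that order) and as the identity on the other components. Similarly, for a map $\mathbf{J}:X^4\to X^4$ and $i<j<k<l$, $\mathbf{J}_{ijkl}$ acts as $\mathbf{J}$ on components $(x_i,x_j,x_k,x_l)$ and as the identity elsewhere. $\mathbf{R}$ is a tetrahedron map if $\mathbf{R}_{245}\mathbf{R}_{135}\mathbf{R}_{126}\mathbf{R}_{346}=\mathbf{R}_{346}\mathbf{R}_{126}\mathbf{R}_{135}\mathbf{R}_{245}$ as maps $X^6\to X^6$. It is involutive if $\mathbf{R}^2=\mathrm{id}$. It is symmetric if $\mathbf{R}=P_{13}\mathbf{R}P_{13}$, where $P_{13}(x_1,x_2,x_3)=(x_3,x_2,x_1)$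 (i.e. $\mathbf{R}_{123}=\mathbf{R}_{321}$). The tetrahedral composite of a tetrahedron map $\mathbf{R}$ is $\mathbf{T}=\mathbf{R}_{245}\mathbf{R}_{135}\mathbf{R}_{126}\mathbf{R}_{346}:X^6\to X^6$. Let $Y=\{(x_1,\dots,x_6)\in X^6\mid x_2=x_3,\ x_5=x_6\}$, and let $\phi:X^4\to Y$, $\phi(x_1,x_2,x_3,x_4)=(x_1,x_2,x_2,x_3,x_4,x_4)$, a bijection with inverse $\varphi:Y\to X^4$. $\mathbf{R}$ is boundarizable if $\mathbf{x}\in Y$ implies $\mathbf{T}(\mathbf{x})\in Y$. In that case its boundarization is $\mathbf{J}:X^4\to X^4$, $\mathbf{J}(\mathbf{x})=\varphi(\mathbf{T}(\phi(\mathbf{x})))$. *)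

theory Defs
  imports Main "HOL-Library.FuncSet"
begin

text \<open>
  The base set is a carrier \<open>X\<close>.  A point of \<open>X^n\<close> with components numbered \<open>1, ..., n\<close>
  is an extensional function on \<open>{1..n}\<close>; the arguments and values of the maps being placed
  (\<open>X^3 \<rightarrow> X^3\<close> and \<open>X^4 \<rightarrow> X^4\<close>) are tuples.
\<close>

definition cart_power :: "'a set \<Rightarrow> nat \<Rightarrow> (nat \<Rightarrow> 'a) set" where
  "cart_power X n = ({1..n} \<rightarrow>\<^sub>E X)"

text \<open>
  The maps \<open>R_{ijk}\<close> and \<open>J_{ijkl}\<close> below are meant for pairwise distinct indices.  They do not
  mention \<open>n\<close>: they restrict to self-maps of each \<open>X^n\<close> containing the given components.
\<close>

definition on3 :: "('a \<times> 'a \<times> 'a \<Rightarrow> 'a \<times> 'a \<times> 'a) \<Rightarrow> nat \<Rightarrow> nat \<Rightarrow> nat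
    \<Rightarrow> (nat \<Rightarrow> 'a) \<Rightarrow> (nat \<Rightarrow> 'a)" where
  "on3 R i j k x = (case R (x i, x j, x k) of (a, b, c) \<Rightarrow> x(i := a, j := b, k := c))"

definition on4 :: "('a \<times> 'a \<times> 'a \<times> 'a \<Rightarrow> 'a \<times> 'a \<times> 'a \<times> 'a) \<Rightarrow> nat \<Rightarrow> nat \<Rightarrow> nat \<Rightarrow> nat
    \<Rightarrow> (nat \<Rightarrow> 'a) \<Rightarrow> (nat \<Rightarrow> 'a)" where
  "on4 J i j k l x =
     (case J (x i, x j, x k, x l) of (a, b, c, d) \<Rightarrow> x(i := a, j := b, k := c, l := d))"

definition tetrahedral_composite :: "('a \<times> 'a \<times> 'a \<Rightarrow> 'a \<times> 'a \<times> 'a)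
    \<Rightarrow> (nat \<Rightarrow> 'a) \<Rightarrow> (nat \<Rightarrow> 'a)" where
  "tetrahedral_composite R = on3 R 2 4 5 \<circ> on3 R 1 3 5 \<circ> on3 R 1 2 6 \<circ> on3 R 3 4 6"

definition tetrahedron_map :: "'a set \<Rightarrow> ('a \<times> 'a \<times> 'a \<Rightarrow> 'a \<times> 'a \<times> 'a) \<Rightarrow> bool" where
  "tetrahedron_map X R \<longleftrightarrow>
     R \<in> X \<times> X \<times> X \<rightarrow> X \<times> X \<times> X \<and>
     (\<forall>x \<in> cart_power X 6.
        (on3 R 2 4 5 \<circ> on3 R 1 3 5 \<circ> on3 R 1 2 6 \<circ> on3 R 3 4 6) x =
        (on3 R 3 4 6 \<circ> on3 R 1 2 6 \<circ> on3 R 1 3 5 \<circ> on3 R 2 4 5) x)"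

definition involutive :: "'a set \<Rightarrow> ('a \<times> 'a \<times> 'a \<Rightarrow> 'a \<times> 'a \<times> 'a) \<Rightarrow> bool" where
  "involutive X R \<longleftrightarrow> (\<forall>x \<in> X \<times> X \<times> X. R (R x) = x)"

definition P13 :: "'a \<times> 'a \<times> 'a \<Rightarrow> 'a \<times> 'a \<times> 'a" where
  "P13 = (\<lambda>(a, b, c). (c, b, a))"

definition symmetric_map :: "'a set \<Rightarrow> ('a \<times> 'a \<times> 'a \<Rightarrow> 'a \<times> 'a \<times> 'a) \<Rightarrow> bool" where
  "symmetric_map X R \<longleftrightarrow> (\<forall>x \<in> X \<times> X \<times> X. R x = (P13 \<circ> R \<circ> P13) x)"

definition bdry_set :: "'a set \<Rightarrow> (nat \<Rightarrow> 'a) set" where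
  "bdry_set X = {x \<in> cart_power X 6. x 2 = x 3 \<and> x 5 = x 6}"

definition bdry_embed :: "'a \<times> 'a \<times> 'a \<times> 'a \<Rightarrow> (nat \<Rightarrow> 'a)" where
  "bdry_embed = (\<lambda>(a, b, c, d).
     (\<lambda>_. undefined)(1 := a, 2 := b, 3 := b, 4 := c, 5 := d, 6 := d))"

definition boundarizable :: "'a set \<Rightarrow> ('a \<times> 'a \<times> 'a \<Rightarrow> 'a \<times> 'a \<times> 'a) \<Rightarrow> bool" where
  "boundarizable X R \<longleftrightarrow>
     (\<forall>x. x \<in> bdry_set X \<longrightarrow> tetrahedral_composite R x \<in> bdry_set X)"

text \<open>Only meaningful on \<open>X^4\<close>, and when \<open>R\<close> is boundarizable.\<close>

definition boundarization :: "'a set \<Rightarrow> ('a \<times> 'a \<times> 'a \<Rightarrow> 'a \<times> 'a \<times> 'a)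
    \<Rightarrow> 'a \<times> 'a \<times> 'a \<times> 'a \<Rightarrow> 'a \<times> 'a \<times> 'a \<times> 'a" where
  "boundarization X R x =
     inv_into (X \<times> X \<times> X \<times> X) bdry_embed (tetrahedral_composite R (bdry_embed x))"

lemma bdry_embed_apply [simp]:
  "bdry_embed (a, b, c, d) 1 = a" "bdry_embed (a, b, c, d) (Suc 0) = a"
  "bdry_embed (a, b, c, d) 2 = b" "bdry_embed (a, b, c, d) 3 = b"
  "bdry_embed (a, b, c, d) 4 = c" "bdry_embed (a, b, c, d) 5 = d"
  "bdry_embed (a, b, c, d) 6 = d"
  by (simp_all add: bdry_embed_def)

lemma bij_betw_bdry_embed: "bij_betw bdry_embed (X \<times> X \<times> X \<times> X) (bdry_set X)"
proof (rule bij_betw_imageI)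
  show "inj_on bdry_embed (X \<times> X \<times> X \<times> X)"
  proof (rule inj_onI)
    fix x y :: "'a \<times> 'a \<times> 'a \<times> 'a"
    assume eq: "bdry_embed x = bdry_embed y"
    show "x = y"
      using fun_cong[OF eq, of 1] fun_cong[OF eq, of 2] fun_cong[OF eq, of 4]
        fun_cong[OF eq, of 5] by (cases x; cases y) simp
  qed
  have "bdry_embed x \<in> bdry_set X" if "x \<in> X \<times> X \<times> X \<times> X" for x
    using that by (auto simp: bdry_embed_def bdry_set_def cart_power_def PiE_iff extensional_def)
  moreover have "x \<in> bdry_embed ` (X \<times> X \<times> X \<times> X)" if x: "x \<in> bdry_set X" for x
  proof (rule image_eqI)
    show "(x 1, x 2, x 4, x 5) \<in> X \<times> X \<times> X \<times> X"
      using x by (auto simp: bdry_set_def cart_power_def PiE_iff)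
    show "x = bdry_embed (x 1, x 2, x 4, x 5)"
    proof
      fix i :: nat
      have "i \<notin> {1..6} \<or> i = 1 \<or> i = 2 \<or> i = 3 \<or> i = 4 \<or> i = 5 \<or> i = 6"
        by auto
      with x show "x i = bdry_embed (x 1, x 2, x 4, x 5) i"
        by (auto simp: bdry_embed_def bdry_set_def cart_power_def PiE_iff extensional_def)
    qed
  qed
  ultimately show "bdry_embed ` (X \<times> X \<times> X \<times> X) = bdry_set X"
    by blast
qed

lemma boundarization_in:
  assumes "boundarizable X R"
  shows "boundarization X R \<in> X \<times> X \<times> X \<times> X \<rightarrow> X \<times> X \<times> X \<times> X"
proof
  fix x assume "x \<in> X \<times> X \<times> X \<times> X"
  then have "tetrahedral_composite R (bdry_embed x) \<in> bdry_set X"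
    using assms bij_betw_bdry_embed[of X] by (auto simp: boundarizable_def bij_betw_def)
  then show "boundarization X R x \<in> X \<times> X \<times> X \<times> X"
    unfolding boundarization_def
    by (intro inv_into_into) (simp only: bij_betw_imp_surj_on[OF bij_betw_bdry_embed])
qed

end

theory Submission
  imports Defs
begin

text \<open>
  Six lines in general position, numbered \<open>1, ..., 6\<close>, have 15 crossings.  The reflection
  \<open>i \<mapsto> 7 - i\<close> fixes the three crossings \<open>34\<close>, \<open>25\<close>, \<open>16\<close> and pairs up the other twelve; the nine
  orbits are the nine components of \<open>X\<^sup>9\<close>.  Pulling a point of \<open>X\<^sup>9\<close> back to the crossings turns each
  \<open>R\<close> of the 3D reflection equation into two commuting copies of \<open>R\<close> at two mirror-image triangles
  of lines, and each \<open>J\<close> into the tetrahedral composite at a mirror-symmetric set of four lines.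
  Both sides thereby become products of \<open>R\<close> over all 20 triangles, and one is carried to the other
  by twelve applications of the tetrahedron equation to four of the six lines.  The involutivity
  and symmetry of \<open>R\<close> make these applications possible regardless of the orientation of the lines.
\<close>

section \<open>Placing R at three components\<close>

text \<open>The index type is left free because components are later indexed by pairs of lines, the
  crossings.\<close>

definition place :: "('a \<times> 'a \<times> 'a \<Rightarrow> 'a \<times> 'a \<times> 'a) \<Rightarrow> 'k \<Rightarrow> 'k \<Rightarrow> 'k
    \<Rightarrow> ('k \<Rightarrow> 'a) \<Rightarrow> ('k \<Rightarrow> 'a)" where
  "place R i j k y = (case R (y i, y j, y k) of (a, b, c) \<Rightarrow> y(i := a, j := b, k := c))"

lemma on3_eq_place: "on3 R i j k = place R i j k"
  by (simp add: fun_eq_iff on3_def place_def)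

lemma place_other: "m \<notin> {i, j, k} \<Longrightarrow> place R i j k y m = y m"
  by (simp add: place_def split: prod.split)

lemma place_commute:
  assumes "{i, j, k} \<inter> {l, m, n} = {}"
  shows "place R i j k (place R l m n y) = place R l m n (place R i j k y)"
proof -
  obtain a b c where 1: "R (y i, y j, y k) = (a, b, c)" by (metis prod_cases3)
  obtain a' b' c' where 2: "R (y l, y m, y n) = (a', b', c')" by (metis prod_cases3)
  have ne: "i \<noteq> l" "i \<noteq> m" "i \<noteq> n" "j \<noteq> l" "j \<noteq> m" "j \<noteq> n" "k \<noteq> l" "k \<noteq> m" "k \<noteq> n"
    using assms by auto
  show ?thesis
    by (simp add: place_def 1 2 ne ne[symmetric] fun_upd_twist[of i] fun_upd_twist[of j]
        fun_upd_twist[of k])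
qed

lemma place_pullback:
  assumes "inj_on p I" and "i \<in> I" "j \<in> I" "k \<in> I"
    and "\<forall>m\<in>I. x m = y (p m)"
  shows "\<forall>m\<in>I. place R i j k x m = place R (p i) (p j) (p k) y (p m)"
proof -
  have p: "p m = p n \<longleftrightarrow> m = n" if "m \<in> I" "n \<in> I" for m n
    using assms(1) that by (simp add: inj_on_eq_iff)
  obtain a b c where "R (y (p i), y (p j), y (p k)) = (a, b, c)" by (metis prod_cases3)
  then show ?thesis
    using assms(2-5) by (simp add: place_def p)
qed

lemma place_in:
  assumes "R \<in> X \<times> X \<times> X \<rightarrow> X \<times> X \<times> X" and "range y \<subseteq> X"
  shows "range (place R i j k y) \<subseteq> X"
proof -
  have "R (y i, y j, y k) \<in> X \<times> X \<times> X"
    using assms by auto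
  then show ?thesis
    using assms(2) by (auto simp: place_def split: prod.split)
qed

lemma place_flip:
  assumes "symmetric_map X R" and "range y \<subseteq> X" and "distinct [i, j, k]"
  shows "place R k j i y = place R i j k y"
proof -
  have "(y i, y j, y k) \<in> X \<times> X \<times> X"
    using assms(2) by auto
  then have R: "R (y i, y j, y k) = P13 (R (P13 (y i, y j, y k)))"
    using assms(1) unfolding symmetric_map_def o_apply by blast
  obtain a b c where 1: "R (y k, y j, y i) = (a, b, c)" by (metis prod_cases3)
  with R have "R (y i, y j, y k) = (c, b, a)"
    by (simp add: P13_def)
  with 1 show ?thesis
    using assms(3) by (auto simp: place_def fun_eq_iff)
qed

lemma place_place:
  assumes "involutive X R" and "range y \<subseteq> X" and "distinct [i, j, k]"
  shows "place R i j k (place R i j k y) = y"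
proof -
  have "(y i, y j, y k) \<in> X \<times> X \<times> X"
    using assms(2) by auto
  then have R: "R (R (y i, y j, y k)) = (y i, y j, y k)"
    using assms(1) unfolding involutive_def by blast
  obtain a b c where "R (y i, y j, y k) = (a, b, c)" by (metis prod_cases3)
  with R show ?thesis
    using assms(3) by (auto simp: place_def fun_eq_iff)
qed

text \<open>Both index triples read \<open>x i\<close>, \<open>x j\<close>, \<open>x k\<close>
  through \<open>h\<close>. They are disjoint, so the copy applied last still sees the old values,
  and the two copies write equal results on each fibre of \<open>h\<close>.\<close>

lemma place_double:
  assumes "distinct [i, j, k]"
    and "\<And>m. h m = i \<longleftrightarrow> m = i1 \<or> m = i2"
    and "\<And>m. h m = j \<longleftrightarrow> m = j1 \<or> m = j2"
    and "\<And>m. h m = k \<longleftrightarrow> m = k1 \<or> m = k2"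
    and "i1 \<noteq> i2" "j1 \<noteq> j2" "k1 \<noteq> k2"
  shows "place R i j k x \<circ> h = place R i1 j1 k1 (place R i2 j2 k2 (x \<circ> h))"
proof -
  obtain a b c where R: "R (x i, x j, x k) = (a, b, c)" by (metis prod_cases3)
  have h: "h i1 = i" "h i2 = i" "h j1 = j" "h j2 = j" "h k1 = k" "h k2 = k"
    using assms(2-4) by auto
  then have ne: "i1 \<noteq> j2" "i1 \<noteq> k2" "j1 \<noteq> i2" "j1 \<noteq> k2" "k1 \<noteq> i2" "k1 \<noteq> j2"
    using assms(1) by auto
  show ?thesis
    using assms(1,5-7) ne by (auto simp: place_def R h fun_eq_iff assms(2-4))
qed

section \<open>Words in the triangles of an arrangement of lines\<close>

type_synonym triangle = "nat \<times> nat \<times> nat"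

fun move :: "('a \<times> 'a \<times> 'a \<Rightarrow> 'a \<times> 'a \<times> 'a) \<Rightarrow> triangle
    \<Rightarrow> (nat \<times> nat \<Rightarrow> 'a) \<Rightarrow> (nat \<times> nat \<Rightarrow> 'a)" where
  "move R (a, b, c) = place R (a, b) (a, c) (b, c)"

fun act :: "('a \<times> 'a \<times> 'a \<Rightarrow> 'a \<times> 'a \<times> 'a) \<Rightarrow> triangle list
    \<Rightarrow> (nat \<times> nat \<Rightarrow> 'a) \<Rightarrow> (nat \<times> nat \<Rightarrow> 'a)" where
  "act R [] y = y"
| "act R (t # w) y = move R t (act R w y)"

lemma act_append: "act R (u @ v) y = act R u (act R v y)"
  by (induction u) simp_all

section \<open>Partial commutation of triangles\<close>

fun crossings :: "triangle \<Rightarrow> (nat \<times> nat) set" where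
  "crossings (a, b, c) = {(a, b), (a, c), (b, c)}"

fun indep :: "triangle \<Rightarrow> triangle \<Rightarrow> bool" where
  "indep s t \<longleftrightarrow> crossings s \<inter> crossings t = {}"

lemma move_commute: "indep s t \<Longrightarrow> move R s (move R t y) = move R t (move R s y)"
  by (cases s; cases t) (simp add: place_commute)

lemma act_commute:
  "list_all (indep t) u \<Longrightarrow> move R t (act R u y) = act R u (move R t y)"
  by (induction u) (simp_all add: move_commute del: indep.simps)

fun take_out :: "triangle \<Rightarrow> triangle list \<Rightarrow> triangle list option" where
  "take_out t [] = None"
| "take_out t (s # w) =
     (if s = t then Some w
      else if indep t s then map_option ((#) s) (take_out t w) else None)"

text \<open>Equality in a partially commutative monoid (Mazurkiewicz traces): words agree up to
  swaps of adjacent independent triangles.\<close>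

fun trace_eq :: "triangle list \<Rightarrow> triangle list \<Rightarrow> bool" where
  "trace_eq [] v \<longleftrightarrow> v = []"
| "trace_eq (t # u) v \<longleftrightarrow> (case take_out t v of None \<Rightarrow> False | Some w \<Rightarrow> trace_eq u w)"

lemma act_take_out: "take_out t v = Some w \<Longrightarrow> act R v y = move R t (act R w y)"
  by (induction v arbitrary: w)
    (auto intro: move_commute[symmetric] simp del: indep.simps move.simps split: if_splits)

lemma act_trace_eq: "trace_eq u v \<Longrightarrow> act R u y = act R v y"
  by (induction u arbitrary: v) (auto split: option.splits simp: act_take_out)

text \<open>
  Rewrites \<open>w\<close> as \<open>u @ f @ v\<close>, where \<open>u\<close> is forced to stay on the left of the triangles \<open>f\<close>
  with all lines in \<open>Q\<close>.
\<close>

fun gather :: "nat set \<Rightarrow> triangle list \<Rightarrow> triangle list \<times> triangle list \<times> triangle list" where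
  "gather Q [] = ([], [], [])"
| "gather Q (t # w) = (case gather Q w of (u, f, v) \<Rightarrow>
     if (case t of (a, b, c) \<Rightarrow> a \<in> Q \<and> b \<in> Q \<and> c \<in> Q) \<and> list_all (indep t) u then (u, t # f, v)
     else if list_all (indep t) (u @ f) then (u, f, t # v)
     else (t # u, f, v))"

lemma act_gather: "gather Q w = (u, f, v) \<Longrightarrow> act R w y = act R (u @ f @ v) y"
proof (induction w arbitrary: u f v)
  case (Cons t w)
  obtain u' f' v' where g: "gather Q w = (u', f', v')" by (metis prod_cases3)
  have IH: "act R w y = act R u' (act R f' (act R v' y))"
    using Cons.IH[OF g] by (simp add: act_append)
  consider "list_all (indep t) u'" "u = u'" "f = t # f'" "v = v'"
    | "list_all (indep t) (u' @ f')" "u = u'" "f = f'" "v = t # v'"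
    | "u = t # u'" "f = f'" "v = v'"
    using Cons.prems by (auto simp: g simp del: indep.simps split: if_splits)
  then show ?case
  proof cases
    case 1
    then show ?thesis
      by (simp add: IH act_append act_commute)
  next
    case 2
    then show ?thesis
      by (simp add: IH act_append act_commute)
  next
    case 3
    then show ?thesis by (simp add: IH act_append)
  qed
qed simp

text \<open>
  The left side \<open>pqrs\<close> of the tetrahedron equation for the lines \<open>a\<close>, \<open>b\<close>, \<open>c\<close>, \<open>d\<close>, and its rotation
  \<open>rspq\<close>, whose reversal \<open>qpsr\<close> represents the same map because \<open>R\<close> is involutive.
\<close>

fun tetra_words :: "nat \<times> nat \<times> nat \<times> nat \<Rightarrow> triangle list list" where
  "tetra_words (a, b, c, d) =
     [[(a, c, d), (b, c, d), (a, b, c), (a, b, d)],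
      [(a, b, c), (a, b, d), (a, c, d), (b, c, d)]]"

text \<open>Two triangles of one tetrahedron word share two lines, hence a crossing, so they are
  never independent and \<open>f\<close> can be compared literally. Returning \<open>w\<close>
  otherwise lets \<open>act_reverse_tetra\<close> hold for every quadruple and word.\<close>

fun reverse_tetra :: "nat \<times> nat \<times> nat \<times> nat \<Rightarrow> triangle list \<Rightarrow> triangle list" where
  "reverse_tetra (a, b, c, d) w = (case gather {a, b, c, d} w of (u, f, v) \<Rightarrow>
     if distinct [a, b, c, d] \<and>
        (f \<in> set (tetra_words (a, b, c, d)) \<or> rev f \<in> set (tetra_words (a, b, c, d)))
     then u @ rev f @ v else w)"

section \<open>The tetrahedron equation for four lines\<close>

locale symmetric_tetrahedron =
  fixes X :: "'a set" and R :: "'a \<times> 'a \<times> 'a \<Rightarrow> 'a \<times> 'a \<times> 'a"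
  assumes tetrahedron: "tetrahedron_map X R"
    and involutive: "involutive X R"
    and symmetric: "symmetric_map X R"
begin

lemma R_in: "R \<in> X \<times> X \<times> X \<rightarrow> X \<times> X \<times> X"
  using tetrahedron by (simp add: tetrahedron_map_def)

lemma move_in: "range y \<subseteq> X \<Longrightarrow> range (move R t y) \<subseteq> X"
  by (cases t) (simp add: place_in[OF R_in])

lemma act_in: "range y \<subseteq> X \<Longrightarrow> range (act R w y) \<subseteq> X"
  by (induction w) (simp_all add: move_in)

text \<open>The components \<open>1, ..., 6\<close> of \<open>X\<^sup>6\<close> in terms of the crossings of four lines.\<close>

definition cross :: "nat \<Rightarrow> nat \<Rightarrow> nat \<Rightarrow> nat \<Rightarrow> nat \<Rightarrow> nat \<times> nat" where
  "cross a b c d m = (if m = 1 then (b, c) else if m = 2 then (a, c) else if m = 3 then (b, d)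
     else if m = 4 then (a, d) else if m = 5 then (c, d) else (a, b))"

lemma atLeast1_6: "{1..6::nat} = {1, 2, 3, 4, 5, 6}"
  by auto

lemma ball_6: "(\<forall>m\<in>{1..6::nat}. P m) \<longleftrightarrow> P 1 \<and> P 2 \<and> P 3 \<and> P 4 \<and> P 5 \<and> P 6"
  unfolding atLeast1_6 by simp

lemma inj_cross: "distinct [a, b, c, d] \<Longrightarrow> inj_on (cross a b c d) {1..6}"
  unfolding inj_on_def ball_6 by (auto simp: cross_def)

text \<open>Components 2, 4, 5 and 1, 3, 5 list the crossings of a triangle in the order of
  \<open>move\<close>; 1, 2, 6 and 3, 4, 6 list them backwards, which the symmetry of
  \<open>R\<close> corrects.\<close>

lemma place_cross:
  assumes "distinct [a, b, c, d]" and "range y \<subseteq> X" and "\<forall>m\<in>{1..6}. x m = y (cross a b c d m)"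
  shows "\<forall>m\<in>{1..6}. on3 R 2 4 5 x m = move R (a, c, d) y (cross a b c d m)"
    and "\<forall>m\<in>{1..6}. on3 R 1 3 5 x m = move R (b, c, d) y (cross a b c d m)"
    and "\<forall>m\<in>{1..6}. on3 R 1 2 6 x m = move R (a, b, c) y (cross a b c d m)"
    and "\<forall>m\<in>{1..6}. on3 R 3 4 6 x m = move R (a, b, d) y (cross a b c d m)"
proof -
  note pb = place_pullback[OF inj_cross[OF assms(1)] _ _ _ assms(3), of _ _ _ R]
  have flip: "place R (b, e) (a, e) (a, b) y = place R (a, b) (a, e) (b, e) y" if "e \<in> {c, d}" for e
    using that assms(1) by (intro place_flip[OF symmetric assms(2)]) auto
  show "\<forall>m\<in>{1..6}. on3 R 2 4 5 x m = move R (a, c, d) y (cross a b c d m)"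
    using pb[of 2 4 5] unfolding on3_eq_place by (simp add: cross_def)
  show "\<forall>m\<in>{1..6}. on3 R 1 3 5 x m = move R (b, c, d) y (cross a b c d m)"
    using pb[of 1 3 5] unfolding on3_eq_place by (simp add: cross_def)
  show "\<forall>m\<in>{1..6}. on3 R 1 2 6 x m = move R (a, b, c) y (cross a b c d m)"
    using pb[of 1 2 6] flip[of c] unfolding on3_eq_place by (simp add: cross_def)
  show "\<forall>m\<in>{1..6}. on3 R 3 4 6 x m = move R (a, b, d) y (cross a b c d m)"
    using pb[of 3 4 6] flip[of d] unfolding on3_eq_place by (simp add: cross_def)
qed

lemma composite_cross:
  assumes "distinct [a, b, c, d]" and "range y \<subseteq> X" and "\<forall>m\<in>{1..6}. x m = y (cross a b c d m)"
  shows "\<forall>m\<in>{1..6}. tetrahedral_composite R x m =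
      act R [(a, c, d), (b, c, d), (a, b, c), (a, b, d)] y (cross a b c d m)"
  unfolding tetrahedral_composite_def comp_def act.simps
  by (intro place_cross[OF assms(1)] move_in assms)

lemma reverse_composite_cross:
  assumes "distinct [a, b, c, d]" and "range y \<subseteq> X" and "\<forall>m\<in>{1..6}. x m = y (cross a b c d m)"
  shows "\<forall>m\<in>{1..6}. (on3 R 3 4 6 \<circ> on3 R 1 2 6 \<circ> on3 R 1 3 5 \<circ> on3 R 2 4 5) x m =
      act R (rev [(a, c, d), (b, c, d), (a, b, c), (a, b, d)]) y (cross a b c d m)"
  unfolding comp_def rev.simps append.simps act.simps
  by (intro place_cross[OF assms(1)] move_in assms)

lemma act_other:
  "p \<notin> (\<Union>t\<in>set w. crossings t) \<Longrightarrow> act R w y p = y p"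
proof (induction w)
  case (Cons t w)
  then show ?case by (cases t) (simp add: place_other)
qed simp

lemma cross_image:
  "p \<notin> cross a b c d ` {1..6} \<Longrightarrow>
    p \<notin> (\<Union>t\<in>{(a, c, d), (b, c, d), (a, b, c), (a, b, d)}. crossings t)"
  unfolding atLeast1_6 by (simp add: cross_def)

text \<open>On the six crossings of the four lines this is the tetrahedron equation; at all other
  pairs neither word acts.\<close>

lemma act_tetra:
  assumes "distinct [a, b, c, d]" and "range y \<subseteq> X"
  defines "w \<equiv> [(a, c, d), (b, c, d), (a, b, c), (a, b, d)]"
  shows "act R w y = act R (rev w) y"
proof
  fix p
  \<comment> \<open>Restricting makes \<open>x\<close> extensional, hence a point of
    \<open>cart_power X 6\<close>.\<close>
  define x where "x = restrict (y \<circ> cross a b c d) {1..6}"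
  have x: "\<forall>m\<in>{1..6}. x m = y (cross a b c d m)" "x \<in> cart_power X 6"
    using assms(2) by (auto simp: x_def cart_power_def)
  show "act R w y p = act R (rev w) y p"
  proof (cases "p \<in> cross a b c d ` {1..6}")
    case True
    then obtain m where m: "m \<in> {1..6}" "p = cross a b c d m" by blast
    have "tetrahedral_composite R x m =
        (on3 R 3 4 6 \<circ> on3 R 1 2 6 \<circ> on3 R 1 3 5 \<circ> on3 R 2 4 5) x m"
      using tetrahedron x(2) unfolding tetrahedron_map_def tetrahedral_composite_def by metis
    then show ?thesis
      unfolding w_def m(2) using m(1) composite_cross[OF assms(1,2) x(1)]
        reverse_composite_cross[OF assms(1,2) x(1)] by metis
  next
    case False
    note p = cross_image[OF False]
    have "p \<notin> (\<Union>t\<in>set w. crossings t)" "p \<notin> (\<Union>t\<in>set (rev w). crossings t)"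
      using p unfolding set_rev w_def by (simp_all del: crossings.simps)
    then show ?thesis by (rule trans[OF act_other act_other[symmetric]])
  qed
qed

lemma move_move: "range y \<subseteq> X \<Longrightarrow> distinct [a, b, c] \<Longrightarrow> move R (a, b, c) (move R (a, b, c) y) = y"
  by (simp add: place_place[OF involutive])

lemma act_tetra_rotated:
  assumes "distinct [a, b, c, d]" and "range y \<subseteq> X"
  defines "w \<equiv> [(a, b, c), (a, b, d), (a, c, d), (b, c, d)]"
  shows "act R w y = act R (rev w) y"
proof -
  let ?p = "move R (a, c, d)" and ?q = "move R (b, c, d)"
    and ?r = "move R (a, b, c)" and ?s = "move R (a, b, d)"
  have inv: "t (t z) = z" if "range z \<subseteq> X" "t \<in> {?p, ?q}" for t z
    using that assms(1) by (auto simp del: move.simps intro!: move_move)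
  have eq: "?p (?q (?r (?s z))) = ?s (?r (?q (?p z)))" if "range z \<subseteq> X" for z
    using act_tetra[OF assms(1) that] by (simp del: move.simps)
  \<comment> \<open>Inserting \<open>?q ?p ?p ?q\<close>, which is the identity, on the left creates
    the factor \<open>?p ?q ?r ?s\<close> to be reversed.\<close>
  have "?r (?s (?p (?q y))) = ?q (?p (?p (?q (?r (?s (?p (?q y)))))))"
    by (simp add: inv move_in assms(2) del: move.simps)
  also have "\<dots> = ?q (?p (?s (?r (?q (?p (?p (?q y)))))))"
    by (simp add: eq move_in assms(2) del: move.simps)
  also have "\<dots> = ?q (?p (?s (?r y)))"
    by (simp add: inv move_in assms(2) del: move.simps)
  finally show ?thesis by (simp add: w_def del: move.simps)
qed

lemma act_rev_tetra_words:
  assumes "distinct [a, b, c, d]" and "range y \<subseteq> X"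
    and "f \<in> set (tetra_words (a, b, c, d)) \<or> rev f \<in> set (tetra_words (a, b, c, d))"
  shows "act R (rev f) y = act R f y"
proof -
  have "act R (rev w) y = act R w y" if "w \<in> set (tetra_words (a, b, c, d))" for w
  proof -
    from that consider "w = [(a, c, d), (b, c, d), (a, b, c), (a, b, d)]"
      | "w = [(a, b, c), (a, b, d), (a, c, d), (b, c, d)]"
      by auto
    then show ?thesis
      by cases (simp_all only: act_tetra[OF assms(1,2)] act_tetra_rotated[OF assms(1,2)])
  qed
  then show ?thesis
    using assms(3) by (metis rev_rev_ident)
qed

lemma act_reverse_tetra:
  assumes "range y \<subseteq> X"
  shows "act R (reverse_tetra q w) y = act R w y"
proof -
  obtain a b c d where q: "q = (a, b, c, d)" by (cases q)
  obtain u f v where g: "gather {a, b, c, d} w = (u, f, v)" by (metis prod_cases3)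
  show ?thesis
    using act_gather[OF g, of R y] act_rev_tetra_words[of a b c d "act R v y" f] act_in[OF assms, of v]
    by (auto simp: q g act_append simp del: tetra_words.simps)
qed

lemma act_fold_reverse_tetra:
  "range y \<subseteq> X \<Longrightarrow> act R (fold reverse_tetra qs w) y = act R w y"
  by (induction qs arbitrary: w) (simp_all add: act_reverse_tetra)

section \<open>Pulling back one \<open>J\<close> and one \<open>R\<close> along a folding\<close>

lemma tetrahedral_composite_bdry_embed:
  assumes "boundarizable X R" and "v \<in> X \<times> X \<times> X \<times> X"
  shows "tetrahedral_composite R (bdry_embed v) = bdry_embed (boundarization X R v)"
proof -
  have "tetrahedral_composite R (bdry_embed v) \<in> bdry_embed ` (X \<times> X \<times> X \<times> X)"
    using assms bij_betw_bdry_embed[of X] by (auto simp: boundarizable_def bij_betw_def)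
  then show ?thesis
    unfolding boundarization_def by (simp add: f_inv_into_f)
qed

text \<open>Read through \<open>cross\<close>, the equations defining \<open>bdry_set\<close>
  identify \<open>(a, c)\<close> with \<open>(b, d)\<close> and \<open>(c, d)\<close> with
  \<open>(a, b)\<close>: invariance under the reflection exchanging \<open>a\<close> with
  \<open>d\<close> and \<open>b\<close> with \<open>c\<close>. So \<open>x \<circ> h\<close> on the
  six crossings is an embedded point of \<open>X^4\<close>.\<close>

lemma on4_double:
  assumes "boundarizable X R" and "\<forall>v \<in> X \<times> X \<times> X \<times> X. J v = boundarization X R v"
    and "range x \<subseteq> X" and "distinct [i, j, k, l]" and "distinct [a, b, c, d]"
    and "\<And>m. h m = i \<longleftrightarrow> m = (b, c)"
    and "\<And>m. h m = j \<longleftrightarrow> m = (a, c) \<or> m = (b, d)"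
    and "\<And>m. h m = k \<longleftrightarrow> m = (a, d)"
    and "\<And>m. h m = l \<longleftrightarrow> m = (c, d) \<or> m = (a, b)"
  shows "on4 J i j k l x \<circ> h = act R [(a, c, d), (b, c, d), (a, b, c), (a, b, d)] (x \<circ> h)"
proof
  fix p
  let ?w = "[(a, c, d), (b, c, d), (a, b, c), (a, b, d)]" and ?v = "(x i, x j, x k, x l)"
  obtain a' b' c' d' where J: "J ?v = (a', b', c', d')" by (metis prod_cases4)
  have h: "h (b, c) = i" "h (a, c) = j" "h (b, d) = j" "h (a, d) = k" "h (c, d) = l" "h (a, b) = l"
    using assms(6-9) by auto
  have v: "?v \<in> X \<times> X \<times> X \<times> X" and y: "range (x \<circ> h) \<subseteq> X"
    using assms(3) by auto
  have "tetrahedral_composite R (bdry_embed ?v) = bdry_embed (J ?v)"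
    using tetrahedral_composite_bdry_embed[OF assms(1) v] assms(2) v by simp
  moreover have "\<forall>m\<in>{1..6}. bdry_embed ?v m = (x \<circ> h) (cross a b c d m)"
    unfolding ball_6 by (simp add: cross_def h)
  ultimately have eq: "\<forall>m\<in>{1..6}. bdry_embed (J ?v) m = act R ?w (x \<circ> h) (cross a b c d m)"
    using composite_cross[OF assms(5) y] by metis
  have on4: "on4 J i j k l x = x(i := a', j := b', k := c', l := d')"
    by (simp add: on4_def J)
  show "(on4 J i j k l x \<circ> h) p = act R ?w (x \<circ> h) p"
  proof (cases "p \<in> cross a b c d ` {1..6}")
    case True
    then obtain m where m: "m \<in> {1..6}" "p = cross a b c d m" by blast
    have "\<forall>m\<in>{1..6}. on4 J i j k l x (h (cross a b c d m)) = bdry_embed (J ?v) m"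
      unfolding ball_6 J on4 using assms(4) by (simp add: cross_def h)
    then show ?thesis using m eq by simp
  next
    case False
    note p = cross_image[OF False]
    then have "act R ?w (x \<circ> h) p = x (h p)"
      by (subst act_other) (simp_all del: crossings.simps)
    moreover have "h p \<notin> {i, j, k, l}"
      using p by (auto simp: assms(6-9))
    ultimately show ?thesis by (simp add: on4)
  qed
qed

text \<open>The reflection reverses the order of the lines, so the mirror copy of \<open>R\<close>
  arises with its crossings listed backwards; symmetry of \<open>R\<close> turns it around.\<close>

lemma on3_double:
  assumes "range x \<subseteq> X" and "distinct [i, j, k]" and "distinct [a, b, c]" "distinct [a', b', c']"
    and "\<And>m. h m = i \<longleftrightarrow> m = (a, b) \<or> m = (b', c')"
    and "\<And>m. h m = j \<longleftrightarrow> m = (a, c) \<or> m = (a', c')"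
    and "\<And>m. h m = k \<longleftrightarrow> m = (b, c) \<or> m = (a', b')"
    and "(a, b) \<noteq> (b', c')" "(a, c) \<noteq> (a', c')" "(b, c) \<noteq> (a', b')"
  shows "on3 R i j k x \<circ> h = act R [(a, b, c), (a', b', c')] (x \<circ> h)"
proof -
  have "range (x \<circ> h) \<subseteq> X" using assms(1) by auto
  from place_flip[OF symmetric this, of "(a', b')" "(a', c')" "(b', c')"] show ?thesis
    unfolding on3_eq_place using assms(4) by (subst place_double[OF assms(2,5-10)]) simp
qed

end

section \<open>Folding the arrangement of six lines\<close>

text \<open>The reflection sends the crossing \<open>(i, j)\<close> to
  \<open>(7 - j, 7 - i)\<close>. Pairs that are not crossings go to the dummy component 0.\<close>

definition orbit :: "nat \<times> nat \<Rightarrow> nat" where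
  "orbit p =
     (if p = (3, 4) then 1
      else if p = (2, 4) \<or> p = (3, 5) then 2
      else if p = (2, 5) then 3
      else if p = (2, 3) \<or> p = (4, 5) then 4
      else if p = (2, 6) \<or> p = (1, 5) then 5
      else if p = (3, 6) \<or> p = (1, 4) then 6
      else if p = (1, 6) then 7
      else if p = (1, 3) \<or> p = (4, 6) then 8
      else if p = (1, 2) \<or> p = (5, 6) then 9
      else 0)"

lemma orbit_eq:
  "orbit p = 1 \<longleftrightarrow> p = (3, 4)"
  "orbit p = 2 \<longleftrightarrow> p = (2, 4) \<or> p = (3, 5)"
  "orbit p = 3 \<longleftrightarrow> p = (2, 5)"
  "orbit p = 4 \<longleftrightarrow> p = (2, 3) \<or> p = (4, 5)"
  "orbit p = 5 \<longleftrightarrow> p = (2, 6) \<or> p = (1, 5)"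
  "orbit p = 6 \<longleftrightarrow> p = (3, 6) \<or> p = (1, 4)"
  "orbit p = 7 \<longleftrightarrow> p = (1, 6)"
  "orbit p = 8 \<longleftrightarrow> p = (1, 3) \<or> p = (4, 6)"
  "orbit p = 9 \<longleftrightarrow> p = (1, 2) \<or> p = (5, 6)"
  by (auto simp: orbit_def)

lemma orbit_surj: "m \<in> {1..9} \<Longrightarrow> m \<in> range orbit"
proof -
  assume "m \<in> {1..9}"
  then have "m = 1 \<or> m = 2 \<or> m = 3 \<or> m = 4 \<or> m = 5 \<or> m = 6 \<or> m = 7 \<or> m = 8 \<or> m = 9"
    by auto
  then have "\<exists>p. orbit p = m"
    by (elim disjE) (auto simp only: orbit_eq)
  then show ?thesis by blast
qed

definition left_word :: "triangle list" where
  "left_word =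
     [(4,5,6), (1,2,3), (1,5,6), (2,5,6), (1,2,5), (1,2,6), (3,5,6), (1,2,4), (2,4,6), (1,3,5),
      (1,4,6), (3,4,6), (1,3,4), (1,3,6), (2,4,5), (3,4,5), (2,3,4), (2,3,5), (2,3,6), (1,4,5)]"

text \<open>The blocks of \<open>left_word\<close> in reverse order, each block itself unreversed.
  The \<open>J\<close> blocks belong to the mirror-symmetric quadruples 2345, 1346, 1256, whose
  triangles thus keep their order; the other twelve quadruples must each be reversed.\<close>

definition right_word :: "triangle list" where
  "right_word =
     [(2,3,6), (1,4,5), (2,4,5), (3,4,5), (2,3,4), (2,3,5), (1,4,6), (3,4,6), (1,3,4), (1,3,6),
      (2,4,6), (1,3,5), (3,5,6), (1,2,4), (1,5,6), (2,5,6), (1,2,5), (1,2,6), (4,5,6), (1,2,3)]"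

text \<open>The sequence of tetrahedron moves was found by a breadth-first search.\<close>

lemma left_word_to_right_word:
  "trace_eq
     (fold reverse_tetra
       [(1,2,4,6), (1,3,4,5), (1,2,4,5), (1,2,3,4), (1,2,3,5), (1,2,3,6),
        (1,4,5,6), (2,4,5,6), (3,4,5,6), (2,3,5,6), (1,3,5,6), (2,3,4,6)] left_word)
     right_word"
  by code_simp

lemma (in symmetric_tetrahedron) act_left_word:
  "range y \<subseteq> X \<Longrightarrow> act R left_word y = act R right_word y"
  using act_trace_eq[OF left_word_to_right_word, of R y] by (simp only: act_fold_reverse_tetra)

locale boundarized_tetrahedron = symmetric_tetrahedron +
  fixes J :: "'a \<times> 'a \<times> 'a \<times> 'a \<Rightarrow> 'a \<times> 'a \<times> 'a \<times> 'a"
  assumes boundarizable: "boundarizable X R"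
    and J: "\<forall>v \<in> X \<times> X \<times> X \<times> X. J v = boundarization X R v"
begin

lemma on3_in: "range x \<subseteq> X \<Longrightarrow> range (on3 R i j k x) \<subseteq> X"
  by (simp add: on3_eq_place place_in[OF R_in])

lemma on4_in:
  assumes "range x \<subseteq> X"
  shows "range (on4 J i j k l x) \<subseteq> X"
proof -
  have v: "(x i, x j, x k, x l) \<in> X \<times> X \<times> X \<times> X"
    using assms by auto
  have "J (x i, x j, x k, x l) \<in> X \<times> X \<times> X \<times> X"
    unfolding J[rule_format, OF v] by (rule funcset_mem[OF boundarization_in[OF boundarizable] v])
  then show ?thesis
    using assms by (auto simp: on4_def split: prod.split)
qed

text \<open>The indices of each factor are the orbits met by a mirror pair of triangles or by a
  mirror-symmetric quadruple of lines.\<close>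

lemma fold_orbit:
  assumes "range x \<subseteq> X"
  shows "on3 R 4 5 6 x \<circ> orbit = act R [(2,3,6), (1,4,5)] (x \<circ> orbit)"
    and "on3 R 2 5 8 x \<circ> orbit = act R [(2,4,6), (1,3,5)] (x \<circ> orbit)"
    and "on3 R 2 6 9 x \<circ> orbit = act R [(3,5,6), (1,2,4)] (x \<circ> orbit)"
    and "on3 R 4 8 9 x \<circ> orbit = act R [(4,5,6), (1,2,3)] (x \<circ> orbit)"
    and "on4 J 1 2 3 4 x \<circ> orbit = act R [(2,4,5), (3,4,5), (2,3,4), (2,3,5)] (x \<circ> orbit)"
    and "on4 J 1 6 7 8 x \<circ> orbit = act R [(1,4,6), (3,4,6), (1,3,4), (1,3,6)] (x \<circ> orbit)"
    and "on4 J 3 5 7 9 x \<circ> orbit = act R [(1,5,6), (2,5,6), (1,2,5), (1,2,6)] (x \<circ> orbit)"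
  by (rule on3_double on4_double[OF boundarizable J], rule assms;
      auto simp: orbit_eq orbit_eq(1)[unfolded One_nat_def])+

lemma reflection_equation:
  assumes "range x \<subseteq> X"
  shows "m \<in> {1..9} \<Longrightarrow>
    (on3 R 4 8 9 \<circ> on4 J 3 5 7 9 \<circ> on3 R 2 6 9 \<circ> on3 R 2 5 8 \<circ> on4 J 1 6 7 8
       \<circ> on4 J 1 2 3 4 \<circ> on3 R 4 5 6) x m =
    (on3 R 4 5 6 \<circ> on4 J 1 2 3 4 \<circ> on4 J 1 6 7 8 \<circ> on3 R 2 5 8 \<circ> on3 R 2 6 9
       \<circ> on4 J 3 5 7 9 \<circ> on3 R 4 8 9) x m" (is "_ \<Longrightarrow> ?f x m = ?g x m")
proof -
  have "?f x \<circ> orbit = act R left_word (x \<circ> orbit)"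
    by (simp only: o_apply fold_orbit on3_in on4_in assms left_word_def act.simps)
  moreover have "?g x \<circ> orbit = act R right_word (x \<circ> orbit)"
    by (simp only: o_apply fold_orbit on3_in on4_in assms right_word_def act.simps)
  moreover have "range (x \<circ> orbit) \<subseteq> X"
    using assms by auto
  ultimately have eq: "?f x \<circ> orbit = ?g x \<circ> orbit"
    by (simp only: act_left_word)
  assume "m \<in> {1..9}"
  \<comment> \<open>Equality of the pullbacks descends because \<open>orbit\<close> reaches every
    component from 1 to 9.\<close>
  then obtain p where p: "m = orbit p" using orbit_surj by blast
  show "?f x m = ?g x m"
    using fun_cong[OF eq, of p] unfolding p comp_apply .
qed

end

section \<open>Locality of the placed maps and passage to \<open>cart_power X 9\<close>\<close>

lemma on3_cong:
  "i \<in> I \<Longrightarrow> j \<in> I \<Longrightarrow> k \<in> I \<Longrightarrow> \<forall>m\<in>I. x m = y m \<Longrightarrow> \<forall>m\<in>I. on3 R i j k x m = on3 R i j k y m"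
  by (simp add: on3_def split: prod.split)

lemma on4_cong:
  "i \<in> I \<Longrightarrow> j \<in> I \<Longrightarrow> k \<in> I \<Longrightarrow> l \<in> I \<Longrightarrow> \<forall>m\<in>I. x m = y m \<Longrightarrow>
    \<forall>m\<in>I. on4 J i j k l x m = on4 J i j k l y m"
  by (simp add: on4_def split: prod.split)

lemma on3_other: "m \<notin> {i, j, k} \<Longrightarrow> on3 R i j k x m = x m"
  by (simp add: on3_def split: prod.split)

lemma on4_other: "m \<notin> {i, j, k, l} \<Longrightarrow> on4 J i j k l x m = x m"
  by (simp add: on4_def split: prod.split)

theorem theorem2p13:
  fixes X :: "'a set"
    and R :: "'a \<times> 'a \<times> 'a \<Rightarrow> 'a \<times> 'a \<times> 'a"
    and J :: "'a \<times> 'a \<times> 'a \<times> 'a \<Rightarrow> 'a \<times> 'a \<times> 'a \<times> 'a"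
  assumes "tetrahedron_map X R"
    and "involutive X R"
    and "symmetric_map X R"
    and "boundarizable X R"
    and "\<forall>x \<in> X \<times> X \<times> X \<times> X. J x = boundarization X R x"
  shows "\<forall>x \<in> cart_power X 9.
    (on3 R 4 8 9 \<circ> on4 J 3 5 7 9 \<circ> on3 R 2 6 9 \<circ> on3 R 2 5 8 \<circ> on4 J 1 6 7 8
       \<circ> on4 J 1 2 3 4 \<circ> on3 R 4 5 6) x =
    (on3 R 4 5 6 \<circ> on4 J 1 2 3 4 \<circ> on4 J 1 6 7 8 \<circ> on3 R 2 5 8 \<circ> on3 R 2 6 9
       \<circ> on4 J 3 5 7 9 \<circ> on3 R 4 8 9) x"
proof
  fix x assume x: "x \<in> cart_power X 9"
  interpret boundarized_tetrahedron X R J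
    using assms by unfold_locales
  let ?f = "on3 R 4 8 9 \<circ> on4 J 3 5 7 9 \<circ> on3 R 2 6 9 \<circ> on3 R 2 5 8 \<circ> on4 J 1 6 7 8
       \<circ> on4 J 1 2 3 4 \<circ> on3 R 4 5 6"
  let ?g = "on3 R 4 5 6 \<circ> on4 J 1 2 3 4 \<circ> on4 J 1 6 7 8 \<circ> on3 R 2 5 8 \<circ> on3 R 2 6 9
       \<circ> on4 J 3 5 7 9 \<circ> on3 R 4 8 9"
  \<comment> \<open>The component at \<open>0\<close>, hit by \<open>orbit\<close>, is \<open>undefined\<close> for \<open>x\<close> and may lie outside \<open>X\<close>.\<close>
  define x' where "x' m = (if m \<in> {1..9} then x m else x 1)" for m
  have x': "range x' \<subseteq> X"
    using x by (auto simp: x'_def cart_power_def PiE_iff)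
  have eq: "\<forall>m\<in>{1..9}. x m = x' m"
    by (simp add: x'_def)
  \<comment> \<open>Every factor computes components 1 to 9 from components 1 to 9 alone, so
    changing \<open>x\<close> elsewhere is harmless.\<close>
  have f: "\<forall>m\<in>{1..9}. ?f x m = ?f x' m" and g: "\<forall>m\<in>{1..9}. ?g x m = ?g x' m"
    unfolding o_apply by (intro on3_cong on4_cong eq; simp)+
  show "?f x = ?g x"
  proof
    fix m
    show "?f x m = ?g x m"
    proof (cases "m \<in> {1..9}")
      case True
      then show ?thesis
        by (simp only: f[rule_format] g[rule_format] reflection_equation[OF x' True])
    next
      case False
      then have "m \<notin> {1, 2, 3, 4, 5, 6, 7, 8, 9}" by auto
      then show ?thesis by (simp add: on3_other on4_other)
    qed
  qed
qed

end
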